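(* Let $r$ be a positive integer, and let $MoT(r)$ be the $N\times N$ mesh of trees, where $N=2^r$. Then $\mathrm{gt}(MoT(r))=2^{2r-1}$.
   Context: A geodesic in a graph $G$ is a shortest path between two vertices. A geodesic is maximal if it is not a (proper) subpath of another geodesic of $G$. A set $S\subseteq V(G)$ is a geodesic transversal of $G$ if every maximal geodesic of $G$ contains at least one vertex of $S$. The geodesic transversal number $\mathrm{gt}(G)$ is the minimum cardinality of a geodesic transversal of $G$. The complete binary tree of dimension $r$ is the rooted tree in which all $2^r$ leaves have the same depth $r$ and all interior vertices have exactly $2$ children. The mesh of trees $MoT(r)$, with $N=2^r$, is constructed on the vertices $(i,j)$, $1\le i,j\le N$, of an $N\times N$ square grid (the edges of the grid are deleted) as follows. For each row $i$, add a complete binary tree of dimension $r$ (a row tree) whose leaves, in the left-to-right order, are $(i,1),\dots,(i,N)$ and whose interior vertices are new; for each column $j$, add a complete binary tree of dimension $r$ (a column tree) whose leaves, in the left-to-right order, are $(1,j),\dots,(N,j)$ and whose interior vertices are new. Interior vertices of different trees are distinct. *)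

theory Defs
  imports "Graph_Theory.Graph_Theory" "HOL-Library.Sublist"
begin

text \<open>
  A finite simple undirected graph is a \<^locale>\<open>pair_graph\<close>: each undirected edge is present as
  a pair of opposite arcs.

  A path is given by its list of vertices, so an undirected path occurs as two lists, one for each
  orientation. Geodesics and maximal geodesics are closed under reversal, hence \<^const>\<open>strict_sublist\<close>
  (being a proper contiguous sublist) suffices to express that a path is a proper subpath
  of another one.
\<close>

definition geodesic :: "'a pair_pre_digraph \<Rightarrow> 'a list \<Rightarrow> bool" where
  "geodesic G p \<longleftrightarrow> vpath p (with_proj G) \<and>
     (\<forall>q. vpath q (with_proj G) \<and> hd q = hd p \<and> last q = last p \<longrightarrow>
        vwalk_length p \<le> vwalk_length q)"

definition maximal_geodesic :: "'a pair_pre_digraph \<Rightarrow> 'a list \<Rightarrow> bool" where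
  "maximal_geodesic G p \<longleftrightarrow> geodesic G p \<and> \<not> (\<exists>q. geodesic G q \<and> strict_sublist p q)"

definition geodesic_transversal :: "'a pair_pre_digraph \<Rightarrow> 'a set \<Rightarrow> bool" where
  "geodesic_transversal G S \<longleftrightarrow>
     S \<subseteq> pverts G \<and> (\<forall>p. maximal_geodesic G p \<longrightarrow> set p \<inter> S \<noteq> {})"

definition gt :: "'a pair_pre_digraph \<Rightarrow> nat" where
  "gt G = (LEAST k. \<exists>S. geodesic_transversal G S \<and> finite S \<and> card S = k)"

lemma gt_attained:
  assumes "finite (pverts G)"
  shows "\<exists>S. geodesic_transversal G S \<and> finite S \<and> card S = gt G"
proof -
  have "geodesic_transversal G (pverts G)"
    unfolding geodesic_transversal_def maximal_geodesic_def geodesic_def vpath_def vwalk_def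
    by (auto simp: Int_absorb2)
  with assms have "\<exists>k S. geodesic_transversal G S \<and> finite S \<and> card S = k"
    by blast
  then show ?thesis
    unfolding gt_def by (rule LeastI_ex)
qed

text \<open>
  The complete binary tree of dimension \<open>r\<close>: the node \<open>(d, k)\<close> is the \<open>k\<close>-th node from the left
  (counting from 1) among the \<open>2 ^ d\<close> nodes of depth \<open>d\<close>; its left and right children are
  \<open>(d + 1, 2 * k - 1)\<close> and \<open>(d + 1, 2 * k)\<close>. The leaves, from left to right, are
  \<open>(r, 1)\<close>, ..., \<open>(r, 2 ^ r)\<close>.
\<close>

definition cbt_child :: "nat \<Rightarrow> (nat \<times> nat) rel" where
  "cbt_child r = {((d, k), (d + 1, c)) | d k c. d < r \<and> k \<in> {1..2 ^ d} \<and> c \<in> {2 * k - 1, 2 * k}}"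

definition complete_binary_tree :: "nat \<Rightarrow> (nat \<times> nat) pair_pre_digraph" where
  "complete_binary_tree r =
     \<lparr> pverts = {(d, k). d \<le> r \<and> k \<in> {1..2 ^ d}}, parcs = cbt_child r \<union> (cbt_child r)\<inverse> \<rparr>"

text \<open>
  \<open>Grid i j\<close> is the grid vertex in row \<open>i\<close> and column \<open>j\<close>; \<open>Row i d k\<close> and \<open>Col j d k\<close> are the interior
  nodes \<open>(d, k)\<close> (so \<open>d < r\<close>) of the \<open>i\<close>-th row tree and of the \<open>j\<close>-th column tree. The functions
  \<open>row_node\<close> and \<open>col_node\<close> embed the complete binary tree as a row tree or column tree, identifying
  its leaves with grid vertices.
\<close>

datatype mot_vertex = Grid nat nat | Row nat nat nat | Col nat nat nat

definition row_node :: "nat \<Rightarrow> nat \<Rightarrow> nat \<times> nat \<Rightarrow> mot_vertex" where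
  "row_node r i = (\<lambda>(d, k). if d = r then Grid i k else Row i d k)"

definition col_node :: "nat \<Rightarrow> nat \<Rightarrow> nat \<times> nat \<Rightarrow> mot_vertex" where
  "col_node r j = (\<lambda>(d, k). if d = r then Grid k j else Col j d k)"

definition MoT :: "nat \<Rightarrow> mot_vertex pair_pre_digraph" where
  "MoT r = (let T = complete_binary_tree r; N = 2 ^ r in
     \<lparr> pverts = (\<Union>i\<in>{1..N}. row_node r i ` pverts T) \<union> (\<Union>j\<in>{1..N}. col_node r j ` pverts T),
       parcs = (\<Union>i\<in>{1..N}. map_prod (row_node r i) (row_node r i) ` parcs T) \<union>
               (\<Union>j\<in>{1..N}. map_prod (col_node r j) (col_node r j) ` parcs T) \<rparr>)"

lemma cbt_child_verts:
  assumes "(x, y) \<in> cbt_child r"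
  shows "x \<in> pverts (complete_binary_tree r)" "y \<in> pverts (complete_binary_tree r)" "fst x < fst y"
  using assms by (auto simp: cbt_child_def complete_binary_tree_def)

lemma cbt_arc_verts:
  assumes "(x, y) \<in> parcs (complete_binary_tree r)"
  shows "x \<in> pverts (complete_binary_tree r)" "y \<in> pverts (complete_binary_tree r)" "fst x \<noteq> fst y"
    "(y, x) \<in> parcs (complete_binary_tree r)"
  using assms cbt_child_verts[of x y r] cbt_child_verts[of y x r]
  by (auto simp: complete_binary_tree_def)

lemma finite_cbt_verts: "finite (pverts (complete_binary_tree r))"
proof (rule finite_subset)
  show "pverts (complete_binary_tree r) \<subseteq> (SIGMA d:{..r}. {1..2 ^ d})"
    by (auto simp: complete_binary_tree_def)
qed auto

lemma finite_cbt_arcs: "finite (parcs (complete_binary_tree r))"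
proof (rule finite_subset)
  show "parcs (complete_binary_tree r) \<subseteq>
      pverts (complete_binary_tree r) \<times> pverts (complete_binary_tree r)"
    using cbt_arc_verts by auto
qed (simp add: finite_cbt_verts)

lemma row_node_neq: "fst x \<noteq> fst y \<Longrightarrow> row_node r i x \<noteq> row_node r i y"
  and col_node_neq: "fst x \<noteq> fst y \<Longrightarrow> col_node r i x \<noteq> col_node r i y"
  by (auto simp: row_node_def col_node_def split: prod.splits if_splits)

lemma MoT_arcE:
  assumes "(u, v) \<in> parcs (MoT r)"
  obtains f x y where "(x, y) \<in> parcs (complete_binary_tree r)" "u = f x" "v = f y"
    "\<exists>i\<in>{1..2 ^ r}. f = row_node r i \<or> f = col_node r i"
  using assms by (fastforce simp: MoT_def Let_def)

lemma pair_graph_MoT: "pair_graph (MoT r)"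
proof
  show "finite (pverts (MoT r))" "finite (parcs (MoT r))"
    by (auto simp: MoT_def Let_def finite_cbt_verts finite_cbt_arcs)
  have *: "u \<in> pverts (MoT r) \<and> v \<in> pverts (MoT r) \<and> u \<noteq> v" if "(u, v) \<in> parcs (MoT r)" for u v
    using that
  proof (cases rule: MoT_arcE)
    case (1 f x y)
    have "f ` pverts (complete_binary_tree r) \<subseteq> pverts (MoT r)"
      using 1(4) unfolding MoT_def Let_def by fastforce
    moreover have "f x \<noteq> f y"
      using 1(4) row_node_neq col_node_neq cbt_arc_verts(3)[OF 1(1)] by metis
    ultimately show ?thesis
      using 1 cbt_arc_verts by blast
  qed
  show "fst e \<in> pverts (MoT r)" "snd e \<in> pverts (MoT r)" "fst e \<noteq> snd e"
    if "e \<in> parcs (MoT r)" for e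
    using *[of "fst e" "snd e"] that by auto
  have "(v, u) \<in> parcs (MoT r)" if "(u, v) \<in> parcs (MoT r)" for u v
    using that
  proof (cases rule: MoT_arcE)
    case (1 f x y)
    have "map_prod f f ` parcs (complete_binary_tree r) \<subseteq> parcs (MoT r)"
      using 1(4) unfolding MoT_def Let_def by fastforce
    then show ?thesis
      using 1 cbt_arc_verts(4)[OF 1(1)] by force
  qed
  then show "symmetric (with_proj (MoT r))"
    by (auto simp: symmetric_def sym_def)
qed

end

theory Submission
  imports Defs
begin

text \<open>
  Upper bound: in each row tree take the parents of the leaves, \<open>N \<cdot> N / 2\<close> vertices in total. A path
  avoiding them stays inside one column tree or one row tree, and a geodesic with both ends in the
  same tree is never maximal: an end at an interior vertex can be extended to a child whose subtree
  misses the other end, and a leaf end in a column tree can be extended into its row tree.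

  Lower bound: the \<open>2 \<times> 2\<close> blocks of grid vertices that are pairs of siblings in both directions,
  together with their four parents, span \<open>(N / 2)\<^sup>2\<close> disjoint 8-cycles. Each half of such a cycle that
  joins opposite grid vertices is a maximal geodesic, and no single vertex meets all four halves, so a
  transversal has at least two vertices in each cycle.
\<close>

section \<open>Walks and geodesics\<close>

lemma vwalk_with_proj_iff:
  "vwalk p (with_proj G) \<longleftrightarrow>
     p \<noteq> [] \<and> set p \<subseteq> pverts G \<and> successively (\<lambda>u v. (u, v) \<in> parcs G) p"
proof -
  have "set (vwalk_arcs p) \<subseteq> parcs G \<longleftrightarrow> successively (\<lambda>u v. (u, v) \<in> parcs G) p"
    by (induction p rule: vwalk_arcs.induct) auto
  then show ?thesis by (auto simp: vwalk_def)
qed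

lemma length_vwalk_to_vpath_le: "length (vwalk_to_vpath p) \<le> length p"
proof (induction p rule: vwalk_to_vpath_induct3)
  case (in_set x xs)
  then show ?case
    using length_dropWhile_le[of "\<lambda>y. y \<noteq> x" xs] by simp
qed auto

lemma geodesic_vwalk: "geodesic G p \<Longrightarrow> vwalk p (with_proj G)"
  by (auto simp: geodesic_def)

text \<open>Geodesics compete only against paths by definition; \<open>vwalk_to_vpath\<close>
  shortcuts a walk to a path with the same ends that is no longer, so walks may serve as
  competitors.\<close>

lemma geodesic_le_vwalk:
  assumes "geodesic G p" "vwalk q (with_proj G)" "hd q = hd p" "last q = last p"
  shows "length p \<le> length q"
proof -
  let ?q = "vwalk_to_vpath q"
  have "vpath ?q (with_proj G)" "hd ?q = hd p" "last ?q = last p"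
    using assms by (simp_all add: vwalk_to_vpath_vpath vwalk_to_vpath_hd vwalk_to_vpath_last)
  then have "vwalk_length p \<le> vwalk_length ?q"
    using assms(1) by (auto simp: geodesic_def)
  moreover have "?q \<noteq> []" "p \<noteq> []" "q \<noteq> []"
    using assms geodesic_vwalk[OF assms(1)]
    by (auto simp: vwalk_with_proj_iff vwalk_to_vpath_nonempty)
  ultimately show ?thesis
    using length_vwalk_to_vpath_le[of q] by (cases p; cases ?q) auto
qed

lemma shortest_vwalk_geodesic:
  assumes p: "vwalk p (with_proj G)"
    and min: "\<And>q. vwalk q (with_proj G) \<Longrightarrow> hd q = hd p \<Longrightarrow> last q = last p \<Longrightarrow> length p \<le> length q"
  shows "geodesic G p"
proof -
  have "distinct p"
  proof (rule ccontr)
    assume "\<not> distinct p"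
    then obtain as bs cs x where dec: "p = as @ [x] @ bs @ [x] @ cs"
      using not_distinct_decomp by blast
    have "vwalk (x # cs) (with_proj G)"
      using p dec vwalkI_append_r[of "x # cs" "as @ x # bs"] by simp
    then have "vwalk (as @ [x] @ cs) (with_proj G)"
      using p unfolding dec by (auto simp: vwalk_with_proj_iff successively_append_iff)
    moreover have "hd (as @ [x] @ cs) = hd p" "last (as @ [x] @ cs) = last p"
      unfolding dec by (cases as; simp)+
    ultimately show False
      using min[of "as @ [x] @ cs"] by (simp add: dec)
  qed
  then show ?thesis
    using p min unfolding geodesic_def by (auto simp: diff_le_mono)
qed

text \<open>\<open>f\<close> drops by at most 1 along each arc, so no walk between these ends has
  fewer than \<open>f (hd p) - f (last p)\<close> arcs. Lengths count vertices, hence the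
  \<open>+ 1\<close>.\<close>

lemma potential_geodesic:
  fixes f :: "'a \<Rightarrow> nat"
  assumes p: "vwalk p (with_proj G)"
    and lip: "\<And>u v. (u, v) \<in> parcs G \<Longrightarrow> f u \<le> f v + 1"
    and drop: "f (last p) + length p \<le> f (hd p) + 1"
  shows "geodesic G p"
proof (rule shortest_vwalk_geodesic[OF p])
  fix q assume q: "vwalk q (with_proj G)" "hd q = hd p" "last q = last p"
  have "f (hd q) + 1 \<le> f (last q) + length q"
    using q(1)
  proof (induction q)
    case (Cons u v es)
    then show ?case using lip[of u v] by simp
  qed simp
  with q drop show "length p \<le> length q" by simp
qed

text \<open>Splicing \<open>q\<close> in place of \<open>p\<close> gives a walk with the same ends
  as the whole geodesic.\<close>

lemma geodesic_infix_le:
  assumes "geodesic G (as @ p @ bs)" "p \<noteq> []"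
    and q: "vwalk q (with_proj G)" "hd q = hd p" "last q = last p"
  shows "length p \<le> length q"
proof -
  have "q \<noteq> []" using q by (simp add: vwalk_with_proj_iff)
  have "vwalk (as @ q @ bs) (with_proj G)"
    using geodesic_vwalk[OF assms(1)] q \<open>p \<noteq> []\<close> \<open>q \<noteq> []\<close>
    by (auto simp: vwalk_with_proj_iff successively_append_iff)
  moreover have "hd (as @ q @ bs) = hd (as @ p @ bs)" "last (as @ q @ bs) = last (as @ p @ bs)"
    using q(2,3) \<open>p \<noteq> []\<close> \<open>q \<noteq> []\<close> by (auto simp add: hd_append last_append)
  ultimately show ?thesis
    using geodesic_le_vwalk[OF assms(1), of "as @ q @ bs"] by simp
qed

lemma geodesic_Cons_not_maximal: "geodesic G (c # p) \<Longrightarrow> \<not> maximal_geodesic G p"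
  unfolding maximal_geodesic_def by (auto simp: strict_sublist_def sublist_Cons_right intro!: exI[of _ "c # p"])

section \<open>Truncated distances\<close>

text \<open>Truncating the distance to \<open>w\<close> at \<open>L\<close> makes it 1-Lipschitz without any connectivity.\<close>

definition tdist :: "'a rel \<Rightarrow> nat \<Rightarrow> 'a \<Rightarrow> 'a \<Rightarrow> nat" where
  "tdist A L w x = (LEAST n. n = L \<or> (x, w) \<in> A ^^ n)"

lemma tdist_cases: "tdist A L w x = L \<or> (x, w) \<in> A ^^ tdist A L w x"
  unfolding tdist_def by (rule LeastI[of _ L]) simp

lemma tdist_le: "tdist A L w x \<le> L"
  and tdist_le_relpow: "(x, w) \<in> A ^^ n \<Longrightarrow> tdist A L w x \<le> n"
  unfolding tdist_def by (auto intro: Least_le)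

lemma tdist_self [simp]: "tdist A L w w = 0"
  using tdist_le_relpow[of w w 0 A L] by simp

lemma tdist_lipschitz: "(a, b) \<in> A \<Longrightarrow> tdist A L w a \<le> tdist A L w b + 1"
  using tdist_cases[of A L w b] tdist_le[of A L w a] relpow_Suc_I2[of a b A w "tdist A L w b"]
    tdist_le_relpow[of a w "Suc (tdist A L w b)" A L]
  by (auto simp del: relpow.simps)

lemma tdist_eqI: "(\<And>n. (x, w) \<in> A ^^ n \<Longrightarrow> L \<le> n) \<Longrightarrow> tdist A L w x = L"
  using tdist_cases[of A L w x] tdist_le[of A L w x] le_antisym by metis

lemma relpow_embed_vwalk:
  assumes "pair_wf_digraph G"
    and f: "\<And>a b. (a, b) \<in> A \<Longrightarrow> (f a, f b) \<in> parcs G"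
    and "(x, w) \<in> A ^^ n" "f w \<in> pverts G"
  shows "\<exists>q. vwalk q (with_proj G) \<and> hd q = f x \<and> last q = f w \<and> length q = Suc n"
  using assms(3)
proof (induction n arbitrary: x)
  case 0
  then show ?case
    using assms(4) by (intro exI[of _ "[f w]"]) (simp add: vwalk_with_proj_iff)
next
  case (Suc n)
  interpret pair_wf_digraph G by fact
  obtain y where "(x, y) \<in> A" "(y, w) \<in> A ^^ n"
    using relpow_Suc_D2[OF Suc.prems] by blast
  then obtain q where q: "vwalk q (with_proj G)" "hd q = f y" "last q = f w" "length q = Suc n"
    using Suc.IH by blast
  have "vwalk (f x # q) (with_proj G)"
    using vwalk_wf_digraph_consI q f[OF \<open>(x, y) \<in> A\<close>] by simp
  with q show ?case
    by (intro exI[of _ "f x # q"]) (auto simp: vwalk_with_proj_iff)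
qed

text \<open>An \<open>A\<close>-path from \<open>x\<close> to \<open>w\<close> with fewer than
  \<open>length p - 1\<close> steps would map under \<open>f\<close> to a walk in \<open>G\<close>
  shorter than \<open>p\<close>; truncation supplies the other inequality.\<close>

lemma tdist_geodesic_ends:
  assumes "pair_wf_digraph G"
    and "\<And>a b. (a, b) \<in> A \<Longrightarrow> (f a, f b) \<in> parcs G"
    and p: "geodesic G p" "hd p = f x" "last p = f w"
  shows "tdist A (length p - 1) w x = length p - 1"
proof (rule tdist_eqI)
  fix n assume n: "(x, w) \<in> A ^^ n"
  have "f w \<in> pverts G"
    using geodesic_vwalk[OF p(1)] p(3) last_in_set[of p] by (auto simp: vwalk_with_proj_iff)
  from relpow_embed_vwalk[where f = f, OF assms(1,2) n this] obtain q
    where "vwalk q (with_proj G)" "hd q = f x" "last q = f w" "length q = Suc n"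
    by blast
  then show "length p - 1 \<le> n"
    using geodesic_le_vwalk[OF p(1), of q] p by simp
qed

section \<open>Extending geodesics of an embedded tree\<close>

lemma cbt_child_parent_unique: "(x, c) \<in> cbt_child r \<Longrightarrow> (y, c) \<in> cbt_child r \<Longrightarrow> x = y"
  by (auto simp: cbt_child_def; presburger)

lemma single_valued_cbt_parent: "single_valued ((cbt_child r)\<inverse>)"
  by (auto intro!: single_valuedI dest: cbt_child_parent_unique)

lemma cbt_child_rtrancl_depth:
  "(x, y) \<in> (cbt_child r)\<^sup>* \<Longrightarrow> x = y \<or> fst x < fst y"
  by (induction rule: rtrancl_induct) (auto dest: cbt_child_verts(3))

text \<open>The ancestors of \<open>w\<close> form a chain because parents are unique, and two
  siblings are never comparable in it.\<close>

lemma cbt_child_avoiding: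
  assumes "(d, k) \<in> pverts (complete_binary_tree r)" "d < r"
  obtains c where "((d, k), c) \<in> cbt_child r" "(c, w) \<notin> (cbt_child r)\<^sup>*"
proof -
  let ?c = "(d + 1, 2 * k - 1)" and ?c' = "(d + 1, 2 * k)"
  have c: "((d, k), ?c) \<in> cbt_child r" "((d, k), ?c') \<in> cbt_child r"
    using assms by (auto simp: cbt_child_def complete_binary_tree_def)
  have "\<not> ((?c, w) \<in> (cbt_child r)\<^sup>* \<and> (?c', w) \<in> (cbt_child r)\<^sup>*)"
  proof
    assume "(?c, w) \<in> (cbt_child r)\<^sup>* \<and> (?c', w) \<in> (cbt_child r)\<^sup>*"
    then have "(w, ?c) \<in> ((cbt_child r)\<inverse>)\<^sup>*" "(w, ?c') \<in> ((cbt_child r)\<inverse>)\<^sup>*"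
      by (auto simp: rtrancl_converse)
    from single_valued_confluent[OF single_valued_cbt_parent this]
    have "(?c', ?c) \<in> (cbt_child r)\<^sup>* \<or> (?c, ?c') \<in> (cbt_child r)\<^sup>*"
      by (auto simp: rtrancl_converse)
    \<comment> \<open>The siblings have equal depth, and they differ because \<open>assms(1)\<close>
      gives \<open>k \<ge> 1\<close>.\<close>
    then show False
      using assms(1) by (auto dest!: cbt_child_rtrancl_depth simp: complete_binary_tree_def)
  qed
  with c that show thesis by blast
qed

text \<open>
  The potential is the distance to \<open>w\<close> in the tree, except that below \<open>c\<close> it is constant, one more
  than at the parent of \<open>c\<close>; it is pulled back to \<open>G\<close> along the retraction \<open>\<pi>\<close>.
\<close>

lemma geodesic_extend_interior:
  fixes f :: "nat \<times> nat \<Rightarrow> 'a"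
  assumes G: "pair_wf_digraph G"
    and f: "\<And>a b. (a, b) \<in> parcs (complete_binary_tree r) \<Longrightarrow> (f a, f b) \<in> parcs G"
    and \<pi>: "\<And>u v. (u, v) \<in> parcs G \<Longrightarrow>
      \<pi> u = \<pi> v \<or> (\<pi> u, \<pi> v) \<in> parcs (complete_binary_tree r)"
    and \<pi>f: "\<And>a. a \<in> pverts (complete_binary_tree r) \<Longrightarrow> \<pi> (f a) = a"
    and p: "geodesic G p" "hd p = f (d, k)" "last p = f w"
    and x: "(d, k) \<in> pverts (complete_binary_tree r)" "d < r"
    and w: "w \<in> pverts (complete_binary_tree r)"
  shows "\<not> maximal_geodesic G p"
proof -
  let ?A = "parcs (complete_binary_tree r)" and ?L = "length p - 1"
  obtain c where c: "((d, k), c) \<in> cbt_child r" "(c, w) \<notin> (cbt_child r)\<^sup>*"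
    using cbt_child_avoiding[OF x] .
  define h where "h a = (if (c, a) \<in> (cbt_child r)\<^sup>* then length p else tdist ?A ?L w a)" for a
  have pne: "p \<noteq> []"
    using geodesic_vwalk[OF p(1)] by (simp add: vwalk_with_proj_iff)
  have L: "tdist ?A ?L w (d, k) = ?L"
    using tdist_geodesic_ends[of G ?A f] G f p by blast
  \<comment> \<open>The subtree below \<open>c\<close> can only be left through its root, to the
    parent \<open>(d, k)\<close>.\<close>
  have bd: "b = (d, k)" if "(b, a) \<in> cbt_child r" "(c, a) \<in> (cbt_child r)\<^sup>*"
    "(c, b) \<notin> (cbt_child r)\<^sup>*" for a b
    using that(2)
  proof (cases rule: rtranclE)
    case base
    then show ?thesis using cbt_child_parent_unique that(1) c(1) by blast
  next
    case (step y)
    then show ?thesis using cbt_child_parent_unique that(1,3) by blast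
  qed
  \<comment> \<open>Leaving the subtree below \<open>c\<close> drops \<open>h\<close> from
    \<open>length p\<close> to \<open>length p - 1\<close>, by \<open>L\<close>; on entering it
    \<open>h\<close> cannot drop, since \<open>tdist\<close> is truncated at
    \<open>length p - 1\<close>.\<close>
  have h: "h a \<le> h b + 1" if ab: "(a, b) \<in> ?A" for a b
  proof -
    have cases: "(a, b) \<in> cbt_child r \<or> (b, a) \<in> cbt_child r"
      using ab by (auto simp: complete_binary_tree_def)
    show ?thesis
    proof (cases "(c, a) \<in> (cbt_child r)\<^sup>* \<and> (c, b) \<notin> (cbt_child r)\<^sup>*")
      case True
      then have "b = (d, k)"
        using cases bd by (meson rtrancl.rtrancl_into_rtrancl)
      then show ?thesis using True L by (simp add: h_def)
    next
      case False
      then show ?thesis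
        using tdist_lipschitz[OF ab, of ?L w] tdist_le[of ?A ?L w a] by (auto simp: h_def)
    qed
  qed
  have fc: "(f c, f (d, k)) \<in> parcs G"
    using c(1) by (intro f) (auto simp: complete_binary_tree_def)
  have "geodesic G (f c # p)"
  proof (rule potential_geodesic[where f = "h \<circ> \<pi>"])
    show "vwalk (f c # p) (with_proj G)"
    proof -
      interpret pair_wf_digraph G by fact
      show ?thesis
        using vwalk_wf_digraph_consI[OF geodesic_vwalk[OF p(1)]] fc p(2) by simp
    qed
    show "(h \<circ> \<pi>) u \<le> (h \<circ> \<pi>) v + 1" if "(u, v) \<in> parcs G" for u v
      using \<pi>[OF that] h by fastforce
    have "h (\<pi> (f c)) = length p"
      using cbt_child_verts(2)[OF c(1)] by (simp add: \<pi>f h_def)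
    then show "(h \<circ> \<pi>) (last (f c # p)) + length (f c # p) \<le> (h \<circ> \<pi>) (hd (f c # p)) + 1"
      using pne p(3) c(2) by (simp add: \<pi>f[OF w] h_def)
  qed
  then show ?thesis by (rule geodesic_Cons_not_maximal)
qed

section \<open>The mesh of trees\<close>

text \<open>\<open>row_proj\<close> and \<open>col_proj\<close> are the coordinates of a map from
  the mesh to the product of two complete binary trees; each collapses every tree of the other
  direction to a leaf.\<close>

fun row_proj :: "nat \<Rightarrow> mot_vertex \<Rightarrow> nat \<times> nat" where
  "row_proj r (Grid i j) = (r, j)"
| "row_proj r (Row i d k) = (d, k)"
| "row_proj r (Col j d k) = (r, j)"

fun col_proj :: "nat \<Rightarrow> mot_vertex \<Rightarrow> nat \<times> nat" where
  "col_proj r (Grid i j) = (r, i)"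
| "col_proj r (Row i d k) = (r, i)"
| "col_proj r (Col j d k) = (d, k)"

lemma proj_simps [simp]:
  "row_proj r (row_node r i x) = x" "col_proj r (row_node r i x) = (r, i)"
  "row_proj r (col_node r i x) = (r, i)" "col_proj r (col_node r i x) = x"
  by (auto simp: row_node_def col_node_def split: prod.splits)

interpretation MoT: pair_graph "MoT r" for r
  by (rule pair_graph_MoT)

lemma pair_wf_MoT: "pair_wf_digraph (MoT r)"
  by unfold_locales

lemma MoT_row_arc:
    "i \<in> {1..2 ^ r} \<Longrightarrow> (x, y) \<in> parcs (complete_binary_tree r) \<Longrightarrow>
      (row_node r i x, row_node r i y) \<in> parcs (MoT r)"
  and MoT_col_arc:
    "i \<in> {1..2 ^ r} \<Longrightarrow> (x, y) \<in> parcs (complete_binary_tree r) \<Longrightarrow>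
      (col_node r i x, col_node r i y) \<in> parcs (MoT r)"
  unfolding MoT_def Let_def by force+

text \<open>Each arc lies in a single tree, which one of the projections collapses. Hence a sum of
  1-Lipschitz functions of the two projections is 1-Lipschitz.\<close>

lemma MoT_arc_proj:
  assumes "(u, v) \<in> parcs (MoT r)"
  shows "col_proj r u = col_proj r v \<and> (row_proj r u, row_proj r v) \<in> parcs (complete_binary_tree r) \<or>
    row_proj r u = row_proj r v \<and> (col_proj r u, col_proj r v) \<in> parcs (complete_binary_tree r)"
  using assms by (cases rule: MoT_arcE) auto

lemma MoT_verts [simp]:
  "Grid i j \<in> pverts (MoT r) \<longleftrightarrow> i \<in> {1..2 ^ r} \<and> j \<in> {1..2 ^ r}"
  "Row i d k \<in> pverts (MoT r) \<longleftrightarrow> i \<in> {1..2 ^ r} \<and> d < r \<and> k \<in> {1..2 ^ d}"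
  "Col j d k \<in> pverts (MoT r) \<longleftrightarrow> j \<in> {1..2 ^ r} \<and> d < r \<and> k \<in> {1..2 ^ d}"
  by (auto simp: MoT_def Let_def complete_binary_tree_def row_node_def col_node_def image_iff
      split: if_splits cong: conj_cong)

text \<open>With numbering from 1, the parent of the \<open>j\<close>-th leaf is
  \<open>j / 2\<close> rounded up, that is \<open>Suc j div 2\<close>.\<close>

lemma cbt_leaf_arc:
  assumes "j \<in> {1..2 ^ Suc s}"
  shows "((s, Suc j div 2), (Suc s, j)) \<in> parcs (complete_binary_tree (Suc s))"
  using assms by (auto simp: complete_binary_tree_def cbt_child_def)

text \<open>A grid vertex is a leaf of exactly two trees, so a path ending there can be prolonged in
  only one way.\<close>

lemma MoT_Grid_arc_iff:
  "(Grid i j, v) \<in> parcs (MoT (Suc s)) \<longleftrightarrow> i \<in> {1..2 ^ Suc s} \<and> j \<in> {1..2 ^ Suc s} \<and>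
     (v = Row i s (Suc j div 2) \<or> v = Col j s (Suc i div 2))" (is "?l \<longleftrightarrow> ?r")
proof
  assume l: ?l
  then have "i \<in> {1..2 ^ Suc s} \<and> j \<in> {1..2 ^ Suc s}"
    using MoT.in_arcsD1 MoT_verts(1) by blast
  moreover have "v = Row i s (Suc j div 2) \<or> v = Col j s (Suc i div 2)"
    using l by (cases rule: MoT_arcE)
      (auto simp: row_node_def col_node_def complete_binary_tree_def cbt_child_def split: if_splits)
  ultimately show ?r by blast
next
  assume ?r
  then show ?l
    using MoT_row_arc[OF _ cbt_arc_verts(4)[OF cbt_leaf_arc], of i s j]
      MoT_col_arc[OF _ cbt_arc_verts(4)[OF cbt_leaf_arc], of j s i]
    by (auto simp: row_node_def col_node_def)
qed

lemma MoT_arc_sym: "(u, v) \<in> parcs (MoT r) \<longleftrightarrow> (v, u) \<in> parcs (MoT r)"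
  using MoT.arcs_symmetric by blast

section \<open>The parents of the leaves in the row trees form a transversal\<close>

lemma geodesic_extend_Grid:
  assumes p: "geodesic (MoT (Suc s)) p" "hd p = Grid i j" "last p = col_node (Suc s) j w"
  shows "\<not> maximal_geodesic (MoT (Suc s)) p"
proof -
  let ?r = "Suc s" and ?A = "parcs (complete_binary_tree (Suc s))" and ?L = "length p - 1"
  let ?c = "Row i s (Suc j div 2)"
  have pne: "p \<noteq> []" and "Grid i j \<in> pverts (MoT ?r)"
    using geodesic_vwalk[OF p(1)] p(2) hd_in_set[of p] by (auto simp: vwalk_with_proj_iff)
  then have ij: "i \<in> {1..2 ^ ?r}" "j \<in> {1..2 ^ ?r}" by auto
  have L: "tdist ?A ?L w (?r, i) = ?L"
    using tdist_geodesic_ends[where f = "col_node ?r j", OF pair_wf_MoT MoT_col_arc[OF ij(2)] p(1) _ p(3)] p(2)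
    by (simp add: col_node_def)
  \<comment> \<open>Distance to \<open>w\<close> in the column direction, plus a toll of 1 off
    column \<open>j\<close>. It equals \<open>length p\<close> at \<open>?c\<close> and 0 at
    \<open>last p\<close>.\<close>
  define f where
    "f v = tdist ?A ?L w (col_proj ?r v) + (if row_proj ?r v = (?r, j) then 0 else 1)" for v
  have "geodesic (MoT ?r) (?c # p)"
  proof (rule potential_geodesic[where f = f])
    show "vwalk (?c # p) (with_proj (MoT ?r))"
      using MoT.vwalk_wf_digraph_consI[OF geodesic_vwalk[OF p(1)]] ij p(2)
      by (simp add: MoT_arc_sym[of _ "Grid i j"] MoT_Grid_arc_iff)
    show "f u \<le> f v + 1" if "(u, v) \<in> parcs (MoT ?r)" for u v
      using MoT_arc_proj[OF that] tdist_lipschitz[of _ _ ?A ?L w] unfolding f_def by fastforce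
    show "f (last (?c # p)) + length (?c # p) \<le> f (hd (?c # p)) + 1"
      using pne p(3) L by (cases p) (auto simp: f_def)
  qed
  then show ?thesis by (rule geodesic_Cons_not_maximal)
qed

section \<open>Paths that avoid the parents of the row leaves\<close>

text \<open>Labels the components left after deleting these parents: whole column trees, grid
  vertices included, and the tops of row trees.\<close>

fun tree_of :: "mot_vertex \<Rightarrow> nat + nat" where
  "tree_of (Grid i j) = Inl j"
| "tree_of (Col j d k) = Inl j"
| "tree_of (Row i d k) = Inr i"

lemma tree_of_arc:
  assumes "(u, v) \<in> parcs (MoT (Suc s))" "\<nexists>i k. u = Row i s k" "\<nexists>i k. v = Row i s k"
  shows "tree_of u = tree_of v"
  using assms by (cases rule: MoT_arcE)
    (auto simp: row_node_def col_node_def complete_binary_tree_def cbt_child_def split: if_splits)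

lemma tree_of_vwalk:
  assumes "vwalk p (with_proj (MoT (Suc s)))" "\<nexists>i k. Row i s k \<in> set p"
  shows "tree_of (hd p) = tree_of (last p)"
  using assms
proof (induction p)
  case (Cons u v es)
  have "tree_of u = tree_of v"
    using Cons.hyps(1) Cons.prems by (intro tree_of_arc[of u v s]) auto
  with Cons show ?case by auto
qed simp

lemma tree_of_Inl:
  assumes "tree_of v = Inl j" "v \<in> pverts (MoT r)"
  shows "\<exists>w\<in>pverts (complete_binary_tree r). v = col_node r j w"
proof (cases v)
  case (Grid i j')
  with assms show ?thesis
    by (intro bexI[of _ "(r, i)"]) (auto simp: col_node_def complete_binary_tree_def)
next
  case (Col j' d k)
  with assms show ?thesis
    by (intro bexI[of _ "(d, k)"]) (auto simp: col_node_def complete_binary_tree_def)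
qed (use assms in simp)

lemma tree_of_Inr:
  assumes "tree_of v = Inr i" "v \<in> pverts (MoT r)"
  shows "\<exists>w\<in>pverts (complete_binary_tree r). v = row_node r i w"
proof (cases v)
  case (Row i' d k)
  with assms show ?thesis
    by (intro bexI[of _ "(d, k)"]) (auto simp: row_node_def complete_binary_tree_def)
qed (use assms in simp_all)

text \<open>Otherwise both ends carry the same label, hence lie in one tree, and the kind of
  \<open>hd p\<close> decides which extension lemma prolongs \<open>p\<close> at its head.\<close>

lemma maximal_geodesic_leaf_parent:
  assumes "maximal_geodesic (MoT (Suc s)) p"
  shows "\<exists>i k. Row i s k \<in> set p"
proof (rule ccontr)
  assume no: "\<nexists>i k. Row i s k \<in> set p"
  let ?r = "Suc s"
  have g: "geodesic (MoT ?r) p"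
    using assms by (simp add: maximal_geodesic_def)
  then have walk: "vwalk p (with_proj (MoT ?r))" by (rule geodesic_vwalk)
  then have V: "hd p \<in> pverts (MoT ?r)" "last p \<in> pverts (MoT ?r)"
    by (auto simp: vwalk_with_proj_iff)
  have same: "tree_of (last p) = tree_of (hd p)"
    using tree_of_vwalk[OF walk] no by simp
  \<comment> \<open>The projections preserve or collapse arcs, as the retraction in
    \<open>geodesic_extend_interior\<close> must.\<close>
  have row: "row_proj ?r u = row_proj ?r v \<or>
      (row_proj ?r u, row_proj ?r v) \<in> parcs (complete_binary_tree ?r)"
    and col: "col_proj ?r u = col_proj ?r v \<or>
      (col_proj ?r u, col_proj ?r v) \<in> parcs (complete_binary_tree ?r)"
    if "(u, v) \<in> parcs (MoT ?r)" for u v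
    using MoT_arc_proj[OF that] by auto
  have "\<not> maximal_geodesic (MoT ?r) p"
  proof (cases "hd p")
    case (Grid i j)
    then obtain w where "last p = col_node ?r j w"
      using tree_of_Inl[OF _ V(2)] same by auto
    with Grid show ?thesis using geodesic_extend_Grid[OF g] by blast
  next
    case (Row i d k)
    then obtain w where w: "w \<in> pverts (complete_binary_tree ?r)" "last p = row_node ?r i w"
      using tree_of_Inr[OF _ V(2)] same by auto
    have "i \<in> {1..2 ^ ?r}" "d < ?r" "(d, k) \<in> pverts (complete_binary_tree ?r)"
      using V(1) Row by (auto simp: complete_binary_tree_def)
    then show ?thesis
      using geodesic_extend_interior[where f = "row_node ?r i" and \<pi> = "row_proj ?r",
          OF pair_wf_MoT MoT_row_arc row proj_simps(1) g _ w(2) _ _ w(1)] Row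
      by (auto simp: row_node_def)
  next
    case (Col j d k)
    then obtain w where w: "w \<in> pverts (complete_binary_tree ?r)" "last p = col_node ?r j w"
      using tree_of_Inl[OF _ V(2)] same by auto
    have "j \<in> {1..2 ^ ?r}" "d < ?r" "(d, k) \<in> pverts (complete_binary_tree ?r)"
      using V(1) Col by (auto simp: complete_binary_tree_def)
    then show ?thesis
      using geodesic_extend_interior[where f = "col_node ?r j" and \<pi> = "col_proj ?r",
          OF pair_wf_MoT MoT_col_arc col proj_simps(4) g _ w(2) _ _ w(1)] Col
      by (auto simp: col_node_def)
  qed
  with assms show False by blast
qed

lemma leaf_parents_transversal:
  "geodesic_transversal (MoT (Suc s)) ((\<lambda>(i, k). Row i s k) ` ({1..2 ^ Suc s} \<times> {1..2 ^ s}))"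
  unfolding geodesic_transversal_def
proof (intro conjI allI impI)
  fix p assume p: "maximal_geodesic (MoT (Suc s)) p"
  then obtain i k where ik: "Row i s k \<in> set p"
    using maximal_geodesic_leaf_parent by blast
  moreover have "set p \<subseteq> pverts (MoT (Suc s))"
    using p geodesic_vwalk by (auto simp: maximal_geodesic_def vwalk_with_proj_iff)
  ultimately have "i \<in> {1..2 ^ Suc s}" "k \<in> {1..2 ^ s}"
    using MoT_verts(2) by blast+
  with ik show "set p \<inter> (\<lambda>(i, k). Row i s k) ` ({1..2 ^ Suc s} \<times> {1..2 ^ s}) \<noteq> {}"
    by force
qed auto

section \<open>Disjoint 8-cycles\<close>

text \<open>Half of an 8-cycle when \<open>i\<close>, \<open>i'\<close> and \<open>j\<close>,
  \<open>j'\<close> are sibling pairs; the middle vertex shares both parents used.\<close>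

definition corner_path :: "nat \<Rightarrow> nat \<Rightarrow> nat \<Rightarrow> nat \<Rightarrow> nat \<Rightarrow> mot_vertex list" where
  "corner_path s i j i' j' =
     [Grid i j, Row i s (Suc j div 2), Grid i j', Col j' s (Suc i' div 2), Grid i' j']"

text \<open>The next vertex beyond either end is forced to continue around the 8-cycle, and the
  other way around is then shorter.\<close>

lemma corner_path_maximal:
  assumes i: "i \<in> {1..2 ^ Suc s}" "i' \<in> {1..2 ^ Suc s}" "i \<noteq> i'" "Suc i div 2 = Suc i' div 2"
    and j: "j \<in> {1..2 ^ Suc s}" "j' \<in> {1..2 ^ Suc s}" "j \<noteq> j'" "Suc j div 2 = Suc j' div 2"
  shows "maximal_geodesic (MoT (Suc s)) (corner_path s i j i' j')" (is "maximal_geodesic ?G ?p")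
proof -
  let ?r = "Suc s" and ?A = "parcs (complete_binary_tree (Suc s))"
  have parents: "Suc m div 2 \<in> {1..2 ^ s}" if "m \<in> {1..2 ^ Suc s}" for m :: nat
    using that by auto
  note V = i j parents[OF i(1)] parents[OF i(2)] parents[OF j(1)] parents[OF j(2)]
  note arcs = MoT_Grid_arc_iff MoT_arc_sym[of "Row _ _ _" "Grid _ _"] MoT_arc_sym[of "Col _ _ _" "Grid _ _"]
  have walk: "vwalk ?p (with_proj ?G)"
    using V by (auto simp: corner_path_def vwalk_with_proj_iff arcs)
  \<comment> \<open>Tree arcs change depth, so distinct leaves are not adjacent.\<close>
  have two: "tdist ?A 2 (?r, m) (?r, m') = 2" if "m \<noteq> m'" for m m' :: nat
  proof (rule tdist_eqI)
    fix n assume n: "((?r, m'), (?r, m)) \<in> ?A ^^ n"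
    have "n \<noteq> 0" using n that by (auto intro: ccontr)
    moreover have "n \<noteq> 1"
      using n cbt_arc_verts(3) by fastforce
    ultimately show "2 \<le> n" by simp
  qed
  have geo: "geodesic ?G ?p"
  proof (rule potential_geodesic[OF walk])
    \<comment> \<open>This falls from 2 + 2 to 0 along the four arcs of the path.\<close>
    let ?f = "\<lambda>v. tdist ?A 2 (?r, j') (row_proj ?r v) + tdist ?A 2 (?r, i') (col_proj ?r v)"
    show "?f u \<le> ?f v + 1" if "(u, v) \<in> parcs ?G" for u v
      using MoT_arc_proj[OF that] tdist_lipschitz[of _ _ ?A 2] by fastforce
    show "?f (last ?p) + length ?p \<le> ?f (hd ?p) + 1"
      using two i(3) j(3) by (simp add: corner_path_def)
  qed
  have "\<not> strict_sublist ?p q" if q: "geodesic ?G q" for q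
  proof
    assume "strict_sublist ?p q"
    then obtain ps ss where dec: "q = ps @ ?p @ ss" and "q \<noteq> ?p"
      by (auto simp: strict_sublist_def sublist_def)
    have q': "distinct q" "successively (\<lambda>u v. (u, v) \<in> parcs ?G) q"
      using q geodesic_vwalk[OF q] by (auto simp: geodesic_def vwalk_with_proj_iff)
    have "ps \<noteq> [] \<or> ss \<noteq> []"
      using dec \<open>q \<noteq> ?p\<close> by auto
    then consider y ss' where "ss = y # ss'" | y ps' where "ps = ps' @ [y]"
      by (metis neq_Nil_conv rev_exhaust)
    then show False
    proof cases
      case 1
      then have "(Grid i' j', y) \<in> parcs ?G"
        using q'(2) by (auto simp: dec successively_append_iff corner_path_def)
      moreover have "y \<noteq> Col j' s (Suc i' div 2)"
        using q'(1) by (auto simp: dec 1 corner_path_def)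
      ultimately have y: "y = Row i' s (Suc j' div 2)"
        by (simp add: MoT_Grid_arc_iff)
      \<comment> \<open>The rest of the 8-cycle: three arcs to \<open>y\<close> instead of
        five.\<close>
      let ?b = "[Grid i j, Col j s (Suc i div 2), Grid i' j, y]"
      have "vwalk ?b (with_proj ?G)"
        using V unfolding y by (auto simp: vwalk_with_proj_iff arcs)
      then have "length (?p @ [y]) \<le> length ?b"
        using q by (intro geodesic_infix_le[of ?G ps _ ss']) (auto simp: dec 1 corner_path_def)
      then show False by (simp add: corner_path_def)
    next
      case 2
      then have "(Grid i j, y) \<in> parcs ?G"
        using q'(2) by (auto simp: dec successively_append_iff corner_path_def MoT_arc_sym[of y])
      moreover have "y \<noteq> Row i s (Suc j div 2)"
        using q'(1) by (auto simp: dec 2 corner_path_def)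
      ultimately have y: "y = Col j s (Suc i div 2)"
        by (simp add: MoT_Grid_arc_iff)
      let ?b = "[y, Grid i' j, Row i' s (Suc j' div 2), Grid i' j']"
      have "vwalk ?b (with_proj ?G)"
        using V unfolding y by (auto simp: vwalk_with_proj_iff arcs)
      then have "length (y # ?p) \<le> length ?b"
        using q by (intro geodesic_infix_le[of ?G ps' _ ss]) (auto simp: dec 2 corner_path_def)
      then show False by (simp add: corner_path_def)
    qed
  qed
  with geo show ?thesis by (auto simp: maximal_geodesic_def)
qed

section \<open>Blocks and counting\<close>

text \<open>For positive \<open>a\<close> and \<open>b\<close> these are the eight vertices of one
  cycle, indexed by the parents of its rows and columns.\<close>

definition block :: "nat \<Rightarrow> nat \<times> nat \<Rightarrow> mot_vertex set" where
  "block s = (\<lambda>(a, b).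
     {Grid i j | i j. Suc i div 2 = a \<and> Suc j div 2 = b} \<union>
     {Row i s b | i. Suc i div 2 = a} \<union> {Col j s a | j. Suc j div 2 = b})"

lemma block_iff:
  "Grid i j \<in> block s (a, b) \<longleftrightarrow> Suc i div 2 = a \<and> Suc j div 2 = b"
  "Row i d k \<in> block s (a, b) \<longleftrightarrow> d = s \<and> k = b \<and> Suc i div 2 = a"
  "Col j d k \<in> block s (a, b) \<longleftrightarrow> d = s \<and> k = a \<and> Suc j div 2 = b"
  by (auto simp: block_def)

lemma block_disjoint: "x \<noteq> y \<Longrightarrow> block s x \<inter> block s y = {}"
  by (auto simp: block_def split: prod.splits)

lemma transversal_block_avoiding:
  assumes S: "geodesic_transversal (MoT (Suc s)) S"
    and ab: "a \<in> {1..2 ^ s}" "b \<in> {1..2 ^ s}"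
  shows "\<exists>y \<in> S \<inter> block s (a, b). y \<noteq> x"
proof -
  let ?I = "{2 * a - 1, 2 * a}" and ?J = "{2 * b - 1, 2 * b}"
  have child: "Suc m div 2 = c \<and> m \<in> {1..2 ^ Suc s}"
    if "m \<in> {2 * c - 1, 2 * c}" "c \<in> {1..2 ^ s}" for m c :: nat
    using that by auto
  have hit: "\<exists>y \<in> S \<inter> block s (a, b). y \<noteq> x"
    if "x \<notin> set (corner_path s i j i' j')"
      "i \<in> ?I" "i' \<in> ?I" "i \<noteq> i'" "j \<in> ?J" "j' \<in> ?J" "j \<noteq> j'" for i j i' j'
  proof -
    note par = child[OF that(2) ab(1)] child[OF that(3) ab(1)]
      child[OF that(5) ab(2)] child[OF that(6) ab(2)]
    then have "maximal_geodesic (MoT (Suc s)) (corner_path s i j i' j')"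
      using that(4,7) by (intro corner_path_maximal) (simp_all only: simp_thms)
    then obtain y where y: "y \<in> set (corner_path s i j i' j')" "y \<in> S"
      using S unfolding geodesic_transversal_def by blast
    have "set (corner_path s i j i' j') \<subseteq> block s (a, b)"
      by (simp only: corner_path_def list.set insert_subset empty_subsetI block_iff
        par[THEN conjunct1] simp_thms)
    then have "y \<in> block s (a, b)" using y(1) by (rule subsetD)
    moreover have "y \<noteq> x" using that(1) y(1) by blast
    ultimately show ?thesis using y(2) by blast
  qed
  define i i' j j' where "i = 2 * a - 1" "i' = 2 * a" "j = 2 * b - 1" "j' = 2 * b"
  note defs = this
  have ne: "i \<noteq> i'" "i' \<noteq> i" "j \<noteq> j'" "j' \<noteq> j"
    using ab by (auto simp: defs)
  have IJ: "i \<in> ?I" "i' \<in> ?I" "j \<in> ?J" "j' \<in> ?J"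
    by (auto simp: defs)
  \<comment> \<open>The first and third paths are complementary halves sharing only
    \<open>Grid i j\<close> and \<open>Grid i' j'\<close>; the second and fourth share only the
    other two corners.\<close>
  have "x \<notin> set (corner_path s i j i' j') \<or> x \<notin> set (corner_path s i' j i j') \<or>
    x \<notin> set (corner_path s i' j' i j) \<or> x \<notin> set (corner_path s i j' i' j)"
    using ne by (cases x) (auto simp only: corner_path_def list.set insert_iff empty_iff
        mot_vertex.inject mot_vertex.distinct simp_thms)
  then show ?thesis
    using hit[of i j i' j'] hit[of i' j i j'] hit[of i' j' i j] hit[of i j' i' j] ne
      IJ by blast
qed

lemma card_transversal_ge:
  assumes S: "geodesic_transversal (MoT (Suc s)) S" "finite S"
  shows "2 * (2 ^ s * 2 ^ s) \<le> card S"
proof -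
  let ?I = "{1..2 ^ s} \<times> {1..2 ^ s} :: (nat \<times> nat) set"
  have two: "2 \<le> card (S \<inter> block s x)" if "x \<in> ?I" for x
  proof -
    obtain a b where ab: "x = (a, b)" "a \<in> {1..2 ^ s}" "b \<in> {1..2 ^ s}"
      using \<open>x \<in> ?I\<close> by auto
    note avoid = transversal_block_avoiding[OF S(1) ab(2,3)]
    \<comment> \<open>\<open>avoid\<close> is used twice: for an arbitrary excluded vertex to get
      \<open>y\<close>, then with \<open>y\<close> excluded to get \<open>z\<close>.\<close>
    obtain y z where "y \<in> S \<inter> block s x" "z \<in> S \<inter> block s x" "z \<noteq> y"
      using avoid unfolding ab(1) by metis
    then show ?thesis
      using card_mono[of "S \<inter> block s x" "{y, z}"] S(2) by simp
  qed
  have "2 * (2 ^ s * 2 ^ s) = (\<Sum>x\<in>?I. 2 :: nat)" by simp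
  also have "\<dots> \<le> (\<Sum>x\<in>?I. card (S \<inter> block s x))"
    by (intro sum_mono two)
  also have "\<dots> = card (\<Union>x\<in>?I. S \<inter> block s x)"
    using S(2) block_disjoint[of _ _ s] by (intro card_UN_disjoint[symmetric] ballI impI) (simp, simp, blast)
  also have "\<dots> \<le> card S"
    using S(2) by (intro card_mono) auto
  finally show ?thesis .
qed

theorem theorem3p4:
  fixes r :: nat
  assumes "r \<ge> 1"
  shows "gt (MoT r) = 2 ^ (2 * r - 1)"
proof -
  obtain s where r: "r = Suc s"
    using assms by (cases r) auto
  let ?S = "(\<lambda>(i, k). Row i s k) ` ({1..2 ^ Suc s} \<times> {1..2 ^ s})"
  \<comment> \<open>Two per block, and equally \<open>2 ^ Suc s\<close> rows with
    \<open>2 ^ s\<close> leaf parents each.\<close>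
  have pow: "(2::nat) ^ (2 * r - 1) = 2 * (2 ^ s * 2 ^ s)"
    by (simp add: r power_add[symmetric] mult_2)
  have "card ?S = 2 * (2 ^ s * 2 ^ s)"
    by (subst card_image) (auto simp: inj_on_def card_cartesian_product)
  then have "gt (MoT r) \<le> 2 * (2 ^ s * 2 ^ s)"
    using leaf_parents_transversal[of s] unfolding gt_def r by (intro Least_le exI[of _ ?S]) auto
  moreover have "2 * (2 ^ s * 2 ^ s) \<le> gt (MoT r)"
    using gt_attained[of "MoT r"] card_transversal_ge[of s] r MoT.pair_finite_verts by metis
  ultimately show ?thesis unfolding pow by (rule le_antisym)
qed

end
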